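(* For each integer $n\ge 2$ there is a quasi-isometric embedding $$f:\mathrm{H}^n\to T^n=T\times\dots\times T\quad (n\text{ factors}),$$ where $T$ is a homogeneous simplicial metric tree whose edges all have length $1$.
   Context: $\mathrm{H}^n$ is the real hyperbolic space of dimension $n$ and of constant curvature $-1$. A simplicial metric tree is a connected graph without circuits, with its edges identified with compact intervals, equipped with the induced path metric; it is homogeneous if all its vertices have the same valence (cardinality of the set of adjacent edges); the valence may be infinite, and $T$ need not be locally compact. Products of metric spaces carry the Euclidean ($\ell^2$) product metric. A (not necessarily continuous) map $f:X\to Y$ between metric spaces is quasi-isometric (a quasi-isometric embedding) if there are constants $l\ge 1$, $m\ge 0$ such that $\frac1l|x-x'|-m\le|f(x)-f(x')|\le l|x-x'|+m$ for all $x,x'\in X$, where $|\cdot-\cdot|$ denotes the distance. *)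

theory Defs
  imports "HOL-Analysis.Analysis" "HOL-Library.Equipollence"
begin

text \<open>
  Metric spaces are given, as in the locale \<^locale>\<open>Metric_space\<close>, by a carrier set and a
  distance function on it.
\<close>

definition quasi_isometric_embedding ::
  "'a set \<Rightarrow> ('a \<Rightarrow> 'a \<Rightarrow> real) \<Rightarrow> 'b set \<Rightarrow> ('b \<Rightarrow> 'b \<Rightarrow> real) \<Rightarrow> ('a \<Rightarrow> 'b) \<Rightarrow> bool" where
  "quasi_isometric_embedding X dX Y dY f \<longleftrightarrow>
     f \<in> X \<rightarrow> Y \<and>
     (\<exists>l\<ge>1. \<exists>m\<ge>0. \<forall>x\<in>X. \<forall>x'\<in>X.
        1 / l * dX x x' - m \<le> dY (f x) (f x') \<and> dY (f x) (f x') \<le> l * dX x x' + m)"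


section \<open>Real hyperbolic space\<close>

text \<open>
  The hyperboloid model of the \<open>n\<close>-dimensional space of constant curvature \<open>-1\<close>. Vectors of
  \<open>(n+1)\<close>-dimensional Minkowski space are functions on \<open>{..n}\<close>, with time coordinate \<open>0\<close>;
  the distance is determined by \<open>cosh d(x, y) = - \<langle>x, y\<rangle>\<close>.
\<close>

definition minkowski :: "nat \<Rightarrow> (nat \<Rightarrow> real) \<Rightarrow> (nat \<Rightarrow> real) \<Rightarrow> real" where
  "minkowski n x y = (\<Sum>i=1..n. x i * y i) - x 0 * y 0"

definition hyperbolic_space :: "nat \<Rightarrow> (nat \<Rightarrow> real) set" where
  "hyperbolic_space n = {x \<in> extensional {..n}. minkowski n x x = -1 \<and> x 0 > 0}"

definition hyperbolic_dist :: "nat \<Rightarrow> (nat \<Rightarrow> real) \<Rightarrow> (nat \<Rightarrow> real) \<Rightarrow> real" where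
  "hyperbolic_dist n x y = arcosh (- minkowski n x y)"


section \<open>Simplicial metric trees\<close>

text \<open>
  A graph is given by its vertex set \<open>V\<close> and its set \<open>E\<close> of two-element edges: loops and
  multiple edges would be circuits of length \<open>1\<close> and \<open>2\<close>. No finiteness is assumed.
\<close>

definition simple_graph :: "'v set \<Rightarrow> 'v set set \<Rightarrow> bool" where
  "simple_graph V E \<longleftrightarrow> (\<forall>e\<in>E. e \<subseteq> V \<and> card e = 2)"

definition graph_connected :: "'v set \<Rightarrow> 'v set set \<Rightarrow> bool" where
  "graph_connected V E \<longleftrightarrow> V \<noteq> {} \<and> (\<forall>u\<in>V. \<forall>v\<in>V. (u, v) \<in> {(a, b). {a, b} \<in> E}\<^sup>*)"

definition circuit :: "'v set set \<Rightarrow> 'v list \<Rightarrow> bool" where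
  "circuit E vs \<longleftrightarrow> 3 \<le> length vs \<and> distinct vs \<and>
     successively (\<lambda>a b. {a, b} \<in> E) vs \<and> {last vs, hd vs} \<in> E"

text \<open>An edge \<open>e\<close> is to be identified with a compact interval of length \<open>len e\<close>.\<close>

definition simplicial_metric_tree :: "'v set \<Rightarrow> 'v set set \<Rightarrow> ('v set \<Rightarrow> real) \<Rightarrow> bool" where
  "simplicial_metric_tree V E len \<longleftrightarrow>
     simple_graph V E \<and> graph_connected V E \<and> (\<nexists>vs. circuit E vs) \<and> (\<forall>e\<in>E. 0 < len e)"

definition homogeneous_graph :: "'v set \<Rightarrow> 'v set set \<Rightarrow> bool" where
  "homogeneous_graph V E \<longleftrightarrow> (\<forall>u\<in>V. \<forall>v\<in>V. {e\<in>E. u \<in> e} \<approx> {e\<in>E. v \<in> e})"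

text \<open>
  Points of the geometric realization in barycentric coordinates: a vertex \<open>v\<close> is the indicator
  function of \<open>{v}\<close>, and a point of an edge \<open>{u, v}\<close> is a convex combination of \<open>u\<close> and \<open>v\<close>.
\<close>

definition tree_points :: "'v set \<Rightarrow> 'v set set \<Rightarrow> ('v \<Rightarrow> real) set" where
  "tree_points V E =
     {p. (\<forall>v. 0 \<le> p v) \<and> {v. p v \<noteq> 0} \<in> {{v} | v. v \<in> V} \<union> E \<and> (\<Sum>v | p v \<noteq> 0. p v) = 1}"

definition edge_points :: "'v set \<Rightarrow> 'v set set \<Rightarrow> 'v set \<Rightarrow> ('v \<Rightarrow> real) set" where
  "edge_points V E e = {p \<in> tree_points V E. {v. p v \<noteq> 0} \<subseteq> e}"

text \<open>
  The distance in the interval \<open>e = {u, v}\<close> is \<open>len e * \<bar>p u - q u\<bar> = len e * \<bar>p v - q v\<bar>\<close>;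
  the symmetric expression avoids choosing an end point.
\<close>

definition edge_dist :: "('v set \<Rightarrow> real) \<Rightarrow> 'v set \<Rightarrow> ('v \<Rightarrow> real) \<Rightarrow> ('v \<Rightarrow> real) \<Rightarrow> real" where
  "edge_dist len e p q = len e * ((\<Sum>v\<in>e. \<bar>p v - q v\<bar>) / 2)"

text \<open>
  The induced path metric is the infimum of the lengths of piecewise linear paths. Such a path is
  given by its break points \<open>c 0, \<dots>, c k\<close> and the edges \<open>s i\<close> containing consecutive ones.
\<close>

definition tree_dist ::
  "'v set \<Rightarrow> 'v set set \<Rightarrow> ('v set \<Rightarrow> real) \<Rightarrow> ('v \<Rightarrow> real) \<Rightarrow> ('v \<Rightarrow> real) \<Rightarrow> real" where
  "tree_dist V E len p q =
     Inf {(\<Sum>i<k. edge_dist len (s i) (c i) (c (Suc i))) | k c s.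
            c 0 = p \<and> c k = q \<and>
            (\<forall>i<k. s i \<in> E \<and> c i \<in> edge_points V E (s i) \<and> c (Suc i) \<in> edge_points V E (s i))}"


section \<open>Powers of a metric space\<close>

definition power_space :: "nat \<Rightarrow> 'a set \<Rightarrow> (nat \<Rightarrow> 'a) set" where
  "power_space n X = {..<n} \<rightarrow>\<^sub>E X"

definition power_dist :: "nat \<Rightarrow> ('a \<Rightarrow> 'a \<Rightarrow> real) \<Rightarrow> (nat \<Rightarrow> 'a) \<Rightarrow> (nat \<Rightarrow> 'a) \<Rightarrow> real" where
  "power_dist n d x y = L2_set (\<lambda>i. d (x i) (y i)) {..<n}"

end

theory Submission
  imports Defs
begin

text \<open>
  Distances are measured by counting walls. In the upper half-space model a point is a pair \<open>(y, t)\<close>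
  of a vector \<open>y\<close> with \<open>n - 1\<close> coordinates and a height \<open>t > 0\<close>. Up to an additive constant, the
  distance of \<open>(y, t)\<close> and \<open>(y', s)\<close> is \<open>ln (h / t) + ln (h / s)\<close>, where the extent \<open>h\<close> is the
  maximum of \<open>t\<close>, \<open>s\<close> and all \<open>\<bar>y i - y' i\<bar>\<close> (lemma \<open>hyperbolic_dist_horo\<close>).

  The vectors \<open>y\<close> live in a space of dimension \<open>n - 1\<close>, and this space has \<open>n\<close> systems of nested
  cubes of sides \<open>r\<^sup>k\<close>, one for each colour \<open>c < n\<close>, such that at every scale every point is well
  inside a cube of at least one colour: shift the standard grid by \<open>c/n\<close>. Shrink each cube to
  its core by removing the outer layer of its subcubes. The cores of one colour are
  still nested or disjoint, but now their boundaries at different levels are far apart, measured at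
  the scale of the smaller level. Over each core erect a box with the height of the cube; its
  boundary is a wall.

  The number of walls of one colour that separate two points is at most a constant multiple of
  \<open>ln (h / t) + ln (h / s)\<close> plus a constant, because the walls of large level that come near
  both points are far from one another (lemma \<open>walls_sym_diff_le\<close>). All colours together have at
  least one separating wall for each scale between \<open>t\<close> and \<open>h\<close> and for each scale between \<open>s\<close> and \<open>h\<close>
  (lemma \<open>walls_diff_ge\<close>). Hence the numbers of separating walls of the \<open>n\<close> colours
  together determine the distance up to multiplicative and additive constants.

  Nested walls are the edges of a tree in which the distance is the number of separating walls. Lemma
  \<open>nested_levels_tree_map\<close> realizes all these trees inside one homogeneous tree: its vertices are
  the finite sets of rationals, and an edge adds a new maximum to a set. A point goes to the set
  of walls that separate it from a base point, coded by rationals in the order in which they are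
  crossed (lemma \<open>tree_dist_ext\<close> computes the distance). The \<open>n\<close> maps obtained in this way
  are the components of the quasi-isometric embedding.
\<close>

section \<open>Trees and their path metric\<close>

lemma successively_nth:
  "successively P xs \<Longrightarrow> Suc i < length xs \<Longrightarrow> P (xs ! i) (xs ! Suc i)"
  by (induction xs arbitrary: i rule: induct_list012) (auto simp: nth_Cons split: nat.splits)

text \<open>
  On a circuit, take a vertex of maximal depth. Its two neighbours there are distinct, but
  both are lower, so both would be its parent.
\<close>

lemma no_circuit_if_unique_lower_neighbour:
  fixes depth :: "'v \<Rightarrow> nat"
  assumes lower: "\<And>a b. {a, b} \<in> E \<Longrightarrow>
    (depth b < depth a \<and> b = par a) \<or> (depth a < depth b \<and> a = par b)"
  shows "\<nexists>vs. circuit E vs"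
proof
  assume "\<exists>vs. circuit E vs"
  then obtain vs where L: "3 \<le> length vs" and dist: "distinct vs"
    and succ: "successively (\<lambda>a b. {a, b} \<in> E) vs" and closed: "{last vs, hd vs} \<in> E"
    unfolding circuit_def by blast
  define L where "L = length vs"
  define nxt where "nxt i = (if Suc i = L then 0 else Suc i)" for i
  define prv where "prv i = (if i = 0 then L - 1 else i - 1)" for i
  have edge: "{vs ! i, vs ! nxt i} \<in> E" if "i < L" for i
  proof (cases "Suc i = L")
    case True
    then have i: "i = length vs - 1" unfolding L_def by arith
    have ne: "vs \<noteq> []" using L by auto
    have "nxt i = 0" using True by (simp add: nxt_def)
    then have "vs ! i = last vs" "vs ! nxt i = hd vs"
      using ne by (simp_all add: i last_conv_nth hd_conv_nth)
    then show ?thesis using closed by simp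
  next
    case False
    then show ?thesis using successively_nth[OF succ, of i] that by (simp add: nxt_def L_def)
  qed
  have "Max ((\<lambda>i. depth (vs ! i)) ` {..<L}) \<in> (\<lambda>i. depth (vs ! i)) ` {..<L}"
    using L by (intro Max_in) (auto simp: L_def lessThan_empty_iff)
  then obtain m where m: "m < L" "Max ((\<lambda>i. depth (vs ! i)) ` {..<L}) = depth (vs ! m)" by auto
  have top: "depth (vs ! i) \<le> depth (vs ! m)" if "i < L" for i
    unfolding m(2)[symmetric] using that by (intro Max_ge) auto
  have lt: "nxt m < L" "prv m < L" and np: "nxt (prv m) = m" "nxt m \<noteq> prv m"
    using m(1) L by (auto simp: nxt_def prv_def L_def split: if_splits)
  have "vs ! nxt m = par (vs ! m)"
    using lower[OF edge[OF m(1)]] top[OF lt(1)] by auto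
  moreover have "vs ! prv m = par (vs ! m)"
    using lower[OF edge[OF lt(2)]] top[OF lt(2)] by (auto simp: np(1))
  ultimately show False
    using lt np(2) nth_eq_iff_index_eq[OF dist, of "nxt m" "prv m"] by (simp add: L_def)
qed

text \<open>
  A walk bounds the distance of two vertices from above, and a function that changes by at most
  \<open>1\<close> along edges bounds it from below: such a function extends affinely to the edges, and then it
  varies along a path by at most the length of the path.
\<close>

lemma tree_dist_vertices:
  fixes g :: "'v \<Rightarrow> real"
  assumes graph: "simple_graph V E" and unit: "\<forall>e\<in>E. len e = 1"
    and walk: "(u, v) \<in> {(a, b). {a, b} \<in> E} ^^ k" and uV: "u \<in> V"
    and lip: "\<And>a b. {a, b} \<in> E \<Longrightarrow> \<bar>g a - g b\<bar> \<le> 1"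
    and far: "real k \<le> \<bar>g u - g v\<bar>"
  shows "tree_dist V E len (indicator {u}) (indicator {v}) = real k"
proof -
  define lens where "lens = {(\<Sum>i<k. edge_dist len (s i) (c i) (c (Suc i))) | k c s.
            c 0 = indicator {u} \<and> c k = indicator {v} \<and>
            (\<forall>i<k. s i \<in> E \<and> c i \<in> edge_points V E (s i) \<and> c (Suc i) \<in> edge_points V E (s i))}"
  \<comment> \<open>The affine extension of \<open>g\<close> to the edges.\<close>
  define G where "G p = (\<Sum>v | p v \<noteq> 0. p v * g v)" for p :: "'v \<Rightarrow> real"
  have two: "\<exists>a b. e = {a, b} \<and> a \<noteq> b \<and> a \<in> V \<and> b \<in> V" if "e \<in> E" for e
    using graph that unfolding simple_graph_def by (metis card_2_iff insert_subset)
  have vertex: "indicator {w} \<in> edge_points V E e" if "e \<in> E" "w \<in> e" for e and w :: 'v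
  proof -
    have *: "{x. (indicator {w} x :: real) \<noteq> 0} = {w}" by (auto simp: indicator_def)
    have "w \<in> V" using graph that unfolding simple_graph_def by blast
    then show ?thesis using that(2)
      unfolding edge_points_def tree_points_def mem_Collect_eq * by simp
  qed
  have edge_le: "\<bar>G p - G q\<bar> \<le> edge_dist len e p q"
    if e: "e \<in> E" and p: "p \<in> edge_points V E e" and q: "q \<in> edge_points V E e" for e p q
  proof -
    obtain a b where ab: "e = {a, b}" "a \<noteq> b" using two[OF e] by blast
    have bary: "r a + r b = 1 \<and> G r = r a * g a + r b * g b" if "r \<in> edge_points V E e" for r
    proof -
      have r: "{v. r v \<noteq> 0} \<subseteq> {a, b}" "(\<Sum>v | r v \<noteq> 0. r v) = 1"
        using that by (auto simp: edge_points_def tree_points_def ab)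
      have "(\<Sum>v | r v \<noteq> 0. r v) = (\<Sum>v\<in>{a, b}. r v)"
        "G r = (\<Sum>v\<in>{a, b}. r v * g v)"
        unfolding G_def using r(1) by (intro sum.mono_neutral_left; auto)+
      then show ?thesis using r(2) ab(2) by simp
    qed
    have pb: "p b = 1 - p a" and qb: "q b = 1 - q a"
      using bary[OF p] bary[OF q] by linarith+
    have "G p - G q = (p a - q a) * (g a - g b)"
      using bary[OF p] bary[OF q] by (simp add: pb qb algebra_simps)
    moreover have "edge_dist len e p q = \<bar>p a - q a\<bar>"
      using unit e ab by (simp add: edge_dist_def pb qb abs_minus_commute)
    moreover have "\<bar>(p a - q a) * (g a - g b)\<bar> \<le> \<bar>p a - q a\<bar>"
      using mult_left_mono[OF lip[of a b], of "\<bar>p a - q a\<bar>"] e by (simp add: abs_mult ab(1))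
    ultimately show ?thesis by simp
  qed
  have ge: "real k \<le> l" if "l \<in> lens" for l
  proof -
    from \<open>l \<in> lens\<close>[unfolded lens_def mem_Collect_eq] obtain j c s where
      *: "l = (\<Sum>i<j. edge_dist len (s i) (c i) (c (Suc i))) \<and>
        c 0 = indicator {u} \<and> c j = indicator {v} \<and>
        (\<forall>i<j. s i \<in> E \<and> c i \<in> edge_points V E (s i) \<and> c (Suc i) \<in> edge_points V E (s i))"
      by (elim exE) (rule that)
    then have l: "l = (\<Sum>i<j. edge_dist len (s i) (c i) (c (Suc i)))"
      and c: "c 0 = indicator {u}" "c j = indicator {v}"
      and s: "\<And>i. i < j \<Longrightarrow> s i \<in> E \<and> c i \<in> edge_points V E (s i) \<and> c (Suc i) \<in> edge_points V E (s i)"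
      by simp_all
    have Gv: "G (indicator {w}) = g w" for w
      by (simp add: G_def indicator_def)
    have "\<bar>g u - g v\<bar> = \<bar>\<Sum>i<j. G (c (Suc i)) - G (c i)\<bar>"
      using sum_lessThan_telescope[of "\<lambda>i. G (c i)" j] by (simp add: c Gv abs_minus_commute)
    also have "\<dots> \<le> (\<Sum>i<j. \<bar>G (c (Suc i)) - G (c i)\<bar>)" by (rule sum_abs)
    also have "\<dots> \<le> l"
      unfolding l by (intro sum_mono) (metis abs_minus_commute edge_le s lessThan_iff)
    finally show ?thesis using far by linarith
  qed
  have "real k \<in> lens"
  proof -
    obtain f where f: "f 0 = u" "f k = v" "\<And>i. i < k \<Longrightarrow> {f i, f (Suc i)} \<in> E"
      using walk unfolding relpow_fun_conv by auto
    have "edge_dist len {f i, f (Suc i)} (indicator {f i}) (indicator {f (Suc i)}) = 1"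
      if "i < k" for i
    proof -
      have "f i \<noteq> f (Suc i)" using two[OF f(3)[OF that]] by (auto simp: doubleton_eq_iff)
      then show ?thesis using unit f(3)[OF that] by (simp add: edge_dist_def)
    qed
    then have "(\<Sum>i<k. edge_dist len {f i, f (Suc i)} (indicator {f i}) (indicator {f (Suc i)}))
      = real k" by simp
    moreover have "\<forall>i<k. {f i, f (Suc i)} \<in> E
        \<and> indicator {f i} \<in> edge_points V E {f i, f (Suc i)}
        \<and> indicator {f (Suc i)} \<in> edge_points V E {f i, f (Suc i)}"
      using f(3) vertex by blast
    ultimately show ?thesis
      unfolding lens_def mem_Collect_eq
      by (intro exI[of _ k] exI[of _ "\<lambda>i. indicator {f i}"] exI[of _ "\<lambda>i. {f i, f (Suc i)}"])
        (simp add: f)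
  qed
  then have "Inf lens = real k"
    using ge by (intro cInf_eq_minimum) auto
  then show ?thesis unfolding tree_dist_def lens_def .
qed

section \<open>The tree of finite sets of rationals, ordered by end extension\<close>

text \<open>
  The vertices are the finite sets of rationals, and the parent of a nonempty one is obtained by
  removing its maximum. Thus a vertex is a finite increasing sequence, its ancestors are
  the initial segments, and it has countably many children because a larger rational can be added in
  countably many ways. There are only countably many finite sets of rationals, so that they can be
  coded by reals.
\<close>

definition fin_code :: "rat set \<Rightarrow> real" where
  "fin_code F = real (to_nat_on (Collect finite) F)"

definition ext_verts :: "real set" where
  "ext_verts = fin_code ` Collect finite"

definition ext_edges :: "real set set" where
  "ext_edges = {{fin_code F, fin_code (F - {Max F})} | F. finite F \<and> F \<noteq> {}}"

lemma fin_code_eq_iff: "finite F \<Longrightarrow> finite G \<Longrightarrow> fin_code F = fin_code G \<longleftrightarrow> F = G"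
  using inj_on_eq_iff[OF inj_on_to_nat_on[OF countable_Collect_finite], of F G]
  by (simp add: fin_code_def)

definition fin_decode :: "real \<Rightarrow> rat set" where
  "fin_decode = inv_into (Collect finite) fin_code"

lemma fin_decode_code [simp]: "finite F \<Longrightarrow> fin_decode (fin_code F) = F"
  unfolding fin_decode_def by (intro inv_into_f_f) (auto simp: inj_on_def fin_code_eq_iff)

lemma ext_edgeE:
  assumes "{a, b} \<in> ext_edges"
  obtains F where "finite F" "F \<noteq> {}" "a = fin_code F" "b = fin_code (F - {Max F})"
  | F where "finite F" "F \<noteq> {}" "b = fin_code F" "a = fin_code (F - {Max F})"
  using assms unfolding ext_edges_def by (auto simp: doubleton_eq_iff)

lemma card_less_Max: "finite F \<Longrightarrow> F \<noteq> {} \<Longrightarrow> card (F - {Max F}) < card F"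
  by (intro card_Diff1_less) auto

lemma simple_graph_ext: "simple_graph ext_verts ext_edges"
  unfolding simple_graph_def
proof
  fix e assume "e \<in> ext_edges"
  then obtain F where F: "e = {fin_code F, fin_code (F - {Max F})}" "finite F" "F \<noteq> {}"
    unfolding ext_edges_def by blast
  have "fin_code F \<noteq> fin_code (F - {Max F})"
  proof
    assume "fin_code F = fin_code (F - {Max F})"
    then have "F = F - {Max F}" by (rule iffD1[OF fin_code_eq_iff[OF F(2) finite_Diff[OF F(2)]]])
    then have "card F = card (F - {Max F})" by (rule arg_cong)
    then show False using card_less_Max[OF F(2,3)] by linarith
  qed
  then show "e \<subseteq> ext_verts \<and> card e = 2" using F by (auto simp: ext_verts_def)
qed

lemma no_circuit_ext: "\<nexists>vs. circuit ext_edges vs"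
proof (rule no_circuit_if_unique_lower_neighbour)
  fix a b assume "{a, b} \<in> ext_edges"
  then show "(card (fin_decode b) < card (fin_decode a) \<and>
        b = fin_code (fin_decode a - {Max (fin_decode a)})) \<or>
      (card (fin_decode a) < card (fin_decode b) \<and>
        a = fin_code (fin_decode b - {Max (fin_decode b)}))"
  proof (cases rule: ext_edgeE)
    case (1 F)
    then show ?thesis using card_less_Max[OF 1(1,2)] by (simp del: card_Diff_insert)
  next
    case (2 F)
    then show ?thesis using card_less_Max[OF 2(1,2)] by (simp del: card_Diff_insert)
  qed
qed

lemma walk_to_initial_segment:
  assumes "finite F" "I \<subseteq> F" "\<And>x y. x \<in> I \<Longrightarrow> y \<in> F \<Longrightarrow> y < x \<Longrightarrow> y \<in> I"
  shows "(fin_code F, fin_code I) \<in> {(a, b). {a, b} \<in> ext_edges} ^^ (card F - card I)"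
  using assms
proof (induction "card F" arbitrary: F)
  case 0
  then show ?case by auto
next
  case (Suc n)
  have finI: "finite I" using Suc.prems finite_subset by blast
  show ?case
  proof (cases "I = F")
    case False
    then have ne: "F \<noteq> {}" using Suc.prems by auto
    have max: "Max F \<in> F" using ne Suc.prems by simp
    have "Max F \<notin> I"
    proof
      assume "Max F \<in> I"
      have "F \<subseteq> I"
      proof
        fix y assume y: "y \<in> F"
        then have "y \<le> Max F" using Suc.prems(1) by simp
        then show "y \<in> I" using \<open>Max F \<in> I\<close> Suc.prems(3) y by (cases "y = Max F") auto
      qed
      then show False using False Suc.prems(2) by blast
    qed
    then have sub: "I \<subseteq> F - {Max F}" using Suc.prems(2) by blast
    have cF: "card (F - {Max F}) = n" using Suc.hyps(2) max Suc.prems(1) by simp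
    have "(fin_code (F - {Max F}), fin_code I) \<in> {(a, b). {a, b} \<in> ext_edges} ^^ (n - card I)"
      using Suc.hyps(1)[of "F - {Max F}"] cF sub Suc.prems by auto
    moreover have "(fin_code F, fin_code (F - {Max F})) \<in> {(a, b). {a, b} \<in> ext_edges}"
      using ne Suc.prems(1) unfolding ext_edges_def by blast
    moreover have "card F - card I = Suc (n - card I)"
      using card_mono[OF _ sub] Suc.prems(1) cF Suc.hyps(2) by auto
    ultimately show ?thesis by (simp only:) (rule relpow_Suc_I2)
  qed simp
qed

lemma relpow_sym: "sym R \<Longrightarrow> (a, b) \<in> R ^^ k \<Longrightarrow> (b, a) \<in> R ^^ k"
proof (induction k arbitrary: b)
  case (Suc k)
  then obtain c where "(a, c) \<in> R ^^ k" "(c, b) \<in> R" by auto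
  then show ?case using Suc by (meson relpow_Suc_I2 symD)
qed simp

lemma sym_edges: "sym {(a, b). {a, b} \<in> E}"
  by (auto simp: sym_def insert_commute)

lemma graph_connected_ext: "graph_connected ext_verts ext_edges"
  unfolding graph_connected_def
proof (intro conjI ballI)
  show "ext_verts \<noteq> {}" unfolding ext_verts_def by (simp add: Collect_empty_eq) (metis finite.emptyI)
  fix u v assume "u \<in> ext_verts" "v \<in> ext_verts"
  then obtain F G where FG: "finite F" "finite G" "u = fin_code F" "v = fin_code G"
    unfolding ext_verts_def by auto
  let ?R = "{(a, b). {a, b} \<in> ext_edges}"
  have "(u, fin_code {}) \<in> ?R\<^sup>*" "(fin_code {}, v) \<in> ?R\<^sup>*"
    using walk_to_initial_segment[of F "{}"] relpow_sym[OF sym_edges walk_to_initial_segment[of G "{}"]] FG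
    by (auto intro: relpow_imp_rtrancl)
  then show "(u, v) \<in> ?R\<^sup>*" by simp
qed

text \<open>
  Every vertex has countably infinite valence: there are countably many edges in total,
  and each rational beyond the maximum of \<open>F\<close> gives an edge from \<open>F\<close> to a child.
\<close>

lemma homogeneous_ext: "homogeneous_graph ext_verts ext_edges"
proof -
  have "{e \<in> ext_edges. v \<in> e} \<approx> (UNIV :: nat set)" if "v \<in> ext_verts" for v
  proof -
    obtain F where F: "finite F" "v = fin_code F"
      using \<open>v \<in> ext_verts\<close> unfolding ext_verts_def by auto
    have "ext_edges \<subseteq> (\<lambda>F. {fin_code F, fin_code (F - {Max F})}) ` Collect finite"
      unfolding ext_edges_def by auto
    then have "countable ext_edges"
      using countable_Collect_finite countable_image countable_subset by blast
    then have ctbl: "countable {e \<in> ext_edges. v \<in> e}" by (rule countable_subset[rotated]) auto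
    let ?A = "{x. \<forall>y\<in>F. y < x}"
    have "{Max (insert 0 F) <..} \<subseteq> ?A"
      using F(1) by (auto intro: le_less_trans[OF Max_ge])
    then have infA: "infinite ?A" using infinite_Ioi infinite_super by blast
    let ?h = "\<lambda>x. {v, fin_code (insert x F)}"
    have MaxA: "Max (insert x F) = x \<and> insert x F - {x} = F" if "x \<in> ?A" for x
      using that F(1) by (auto intro!: Max_eqI)
    have sub: "?h ` ?A \<subseteq> {e \<in> ext_edges. v \<in> e}"
    proof clarify
      fix x assume "\<forall>y\<in>F. y < x"
      then have "?h x = {fin_code (insert x F), fin_code (insert x F - {Max (insert x F)})}"
        using MaxA[of x] F(2) by auto
      then show "?h x \<in> ext_edges \<and> v \<in> ?h x" using F(1) unfolding ext_edges_def by blast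
    qed
    have "inj_on ?h ?A"
    proof (rule inj_onI)
      fix x y assume xy: "x \<in> ?A" "y \<in> ?A" "?h x = ?h y"
      have "x \<notin> F" "y \<notin> F" using xy by auto
      then show "x = y" using xy F by (auto simp: doubleton_eq_iff fin_code_eq_iff)
    qed
    then have "infinite (?h ` ?A)" using infA by (simp add: finite_image_iff)
    then have "infinite {e \<in> ext_edges. v \<in> e}" using sub infinite_super by blast
    then show ?thesis using to_nat_on_infinite[OF ctbl] unfolding eqpoll_def by blast
  qed
  then show ?thesis unfolding homogeneous_graph_def by (meson eqpoll_sym eqpoll_trans)
qed

lemma simplicial_metric_tree_ext: "simplicial_metric_tree ext_verts ext_edges (\<lambda>_. 1)"
  using simple_graph_ext graph_connected_ext no_circuit_ext
  unfolding simplicial_metric_tree_def by simp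

text \<open>
  The nonempty ancestors of a vertex, itself included. The cardinality of the symmetric difference
  of the \<open>cuts\<close> of two vertices is their graph distance, in a form that visibly changes by at most
  \<open>1\<close> along an edge.
\<close>

definition cuts :: "rat set \<Rightarrow> rat set set" where
  "cuts F = (\<lambda>x. F \<inter> {..x}) ` F"

lemma cuts_remove_Max:
  assumes "finite F" "F \<noteq> {}"
  shows "cuts F = insert F (cuts (F - {Max F}))"
proof -
  let ?P = "F - {Max F}"
  have F: "F = insert (Max F) ?P" using Max_in[OF assms] by auto
  have lt: "x < Max F" if "x \<in> ?P" for x
    using that Max_ge[OF assms(1), of x] by (simp add: order_le_less)
  have "cuts F = (\<lambda>x. F \<inter> {..x}) ` insert (Max F) ?P"
    using arg_cong[OF F, of "image (\<lambda>x. F \<inter> {..x})"] unfolding cuts_def .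
  also have "\<dots> = insert (F \<inter> {..Max F}) ((\<lambda>x. F \<inter> {..x}) ` ?P)" by (rule image_insert)
  also have "F \<inter> {..Max F} = F" using assms by (auto intro: Max_ge)
  also have "(\<lambda>x. F \<inter> {..x}) ` ?P = (\<lambda>x. ?P \<inter> {..x}) ` ?P"
  proof (intro image_cong refl)
    show "F \<inter> {..x} = ?P \<inter> {..x}" if "x \<in> ?P" for x using lt[OF that] by auto
  qed
  finally show ?thesis unfolding cuts_def .
qed

lemma cut_inj:
  fixes x y :: rat
  assumes "x \<in> F" "y \<in> G" "F \<inter> {..x} = G \<inter> {..y}"
  shows "x = y"
proof -
  have "x \<in> F \<inter> {..x}" using assms(1) by simp
  then have "x \<le> y" unfolding assms(3) by simp
  have "y \<in> G \<inter> {..y}" using assms(2) by simp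
  then have "y \<le> x" unfolding assms(3)[symmetric] by simp
  with \<open>x \<le> y\<close> show ?thesis by simp
qed

lemma card_cuts_diff:
  assumes "\<And>x y. x \<in> F \<inter> G \<Longrightarrow> y \<in> F \<union> G \<Longrightarrow> y < x \<Longrightarrow> y \<in> F \<inter> G"
  shows "card (cuts F - cuts G) = card (F - G)"
proof -
  have eq: "F \<inter> {..x} = G \<inter> {..x}" if "x \<in> F \<inter> G" for x
  proof -
    have "y \<in> F \<longleftrightarrow> y \<in> G" if "y \<le> x" for y
      using assms[OF \<open>x \<in> F \<inter> G\<close>, of y] \<open>x \<in> F \<inter> G\<close> that by (cases "y = x") auto
    then show ?thesis by auto
  qed
  have "cuts F - cuts G = (\<lambda>x. F \<inter> {..x}) ` (F - G)"
  proof (intro equalityI subsetI)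
    fix A assume "A \<in> cuts F - cuts G"
    then obtain x where "x \<in> F" "A = F \<inter> {..x}" "A \<notin> cuts G" unfolding cuts_def by auto
    moreover have "x \<notin> G" using calculation eq[of x] by (auto simp: cuts_def)
    ultimately show "A \<in> (\<lambda>x. F \<inter> {..x}) ` (F - G)" by blast
  next
    fix A assume "A \<in> (\<lambda>x. F \<inter> {..x}) ` (F - G)"
    then obtain x where x: "x \<in> F" "x \<notin> G" "A = F \<inter> {..x}" by auto
    then have "A \<notin> cuts G" using cut_inj[of x F _ G] unfolding cuts_def by blast
    then show "A \<in> cuts F - cuts G" using x unfolding cuts_def by blast
  qed
  moreover have "inj_on (\<lambda>x. F \<inter> {..x}) (F - G)"
    by (intro inj_onI) (meson DiffD1 cut_inj)
  ultimately show ?thesis by (simp add: card_image)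
qed

lemma finite_cuts: "finite F \<Longrightarrow> finite (cuts F)"
  by (simp add: cuts_def)

text \<open>
  If \<open>F \<inter> G\<close> is an initial segment of both sets, then it is their last common ancestor, and the
  geodesic removes \<open>F - G\<close> and then adds \<open>G - F\<close>. The matching lower bound comes from the number of
  ancestors that are not shared with \<open>G\<close>.
\<close>

lemma tree_dist_ext:
  assumes "finite F" "finite G"
    and initial: "\<And>x y. x \<in> F \<inter> G \<Longrightarrow> y \<in> F \<union> G \<Longrightarrow> y < x \<Longrightarrow> y \<in> F \<inter> G"
  shows "tree_dist ext_verts ext_edges (\<lambda>_. 1) (indicator {fin_code F}) (indicator {fin_code G})
    = real (card (sym_diff F G))"
proof (rule tree_dist_vertices[OF simple_graph_ext])
  let ?R = "{(a, b). {a, b} \<in> ext_edges}"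
  \<comment> \<open>The distance to \<open>G\<close>, as a function on the vertices.\<close>
  let ?g = "\<lambda>a. real (card (sym_diff (cuts (fin_decode a)) (cuts G)))"
  have down: "(fin_code F, fin_code (F \<inter> G)) \<in> ?R ^^ (card F - card (F \<inter> G))"
    and up: "(fin_code G, fin_code (F \<inter> G)) \<in> ?R ^^ (card G - card (F \<inter> G))"
    using assms by (intro walk_to_initial_segment; auto)+
  have "(fin_code F, fin_code G) \<in> ?R ^^ ((card F - card (F \<inter> G)) + (card G - card (F \<inter> G)))"
    unfolding relpow_add by (rule relcompI[OF down relpow_sym[OF sym_edges up]])
  moreover have "card F - card (F \<inter> G) = card (F - G)" "card G - card (F \<inter> G) = card (G - F)"
    using assms(1,2) card_Diff_subset_Int[of F G] card_Diff_subset_Int[of G F]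
    by (simp_all add: Int_commute)
  moreover have "card (sym_diff F G) = card (F - G) + card (G - F)"
    using assms(1,2) by (intro card_Un_disjoint) auto
  ultimately show "(fin_code F, fin_code G) \<in> ?R ^^ card (sym_diff F G)" by simp
  have "card (sym_diff (cuts F) (cuts G)) = card (cuts F - cuts G) + card (cuts G - cuts F)"
    using finite_cuts assms(1,2) by (intro card_Un_disjoint) auto
  also have "\<dots> = card (F - G) + card (G - F)"
    using initial by (subst (1 2) card_cuts_diff) (auto simp: Int_commute Un_commute)
  also have "\<dots> = card (sym_diff F G)"
    using assms(1,2) by (intro card_Un_disjoint[symmetric]) auto
  finally show "real (card (sym_diff F G)) \<le> \<bar>?g (fin_code F) - ?g (fin_code G)\<bar>"
    using assms(1,2) by simp
  have step: "\<bar>real (card (sym_diff (insert c A) B)) - real (card (sym_diff A B))\<bar> \<le> 1"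
    if "finite A" "finite B" for c :: "rat set" and A B
  proof -
    have "card (sym_diff (insert c A) B) \<le> card (insert c (sym_diff A B))"
      "card (sym_diff A B) \<le> card (insert c (sym_diff (insert c A) B))"
      using that by (intro card_mono; auto)+
    moreover have "card (insert c (sym_diff A B)) \<le> Suc (card (sym_diff A B))"
      "card (insert c (sym_diff (insert c A) B)) \<le> Suc (card (sym_diff (insert c A) B))"
      using that by (simp_all add: card_insert_if)
    ultimately show ?thesis by linarith
  qed
  show "\<bar>?g a - ?g b\<bar> \<le> 1" if "{a, b} \<in> ext_edges" for a b
    using that
  proof (cases rule: ext_edgeE)
    case (1 H)
    then show ?thesis
      using step[of "cuts (H - {Max H})" "cuts G" H] finite_cuts assms(2)
      by (simp add: cuts_remove_Max[of H])
  next
    case (2 H)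
    then show ?thesis
      using step[of "cuts (H - {Max H})" "cuts G" H] finite_cuts assms(2)
      by (simp add: cuts_remove_Max[of H] abs_minus_commute)
  qed
  show "fin_code F \<in> ext_verts" using assms(1) by (simp add: ext_verts_def)
qed simp

section \<open>From families nested by level to maps into the tree\<close>

text \<open>
  A rational that determines \<open>i\<close> and lies in the interval from \<open>2\<^sup>-\<^sup>k\<close> to \<open>3/2 * 2\<^sup>-\<^sup>k\<close>, where \<open>k\<close> is the
  level of \<open>i\<close>. These intervals are disjoint for different levels, so that higher levels have
  smaller weights.
\<close>

definition letter_weight :: "int \<times> 'b :: countable \<Rightarrow> rat" where
  "letter_weight i = 2 powi (- fst i) * (1 + 1 / of_nat (to_nat (snd i) + 2))"

lemma letter_weight_pos: "0 < letter_weight i"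
  by (simp add: letter_weight_def add_pos_nonneg)

lemma letter_weight_less:
  assumes "fst i < fst j"
  shows "letter_weight j < letter_weight i"
proof -
  have "letter_weight j \<le> 2 powi (- fst j) * (1 + 1 / 2)"
    unfolding letter_weight_def by (intro mult_left_mono add_left_mono) (auto simp: field_simps)
  also have "\<dots> < 2 * 2 powi (- fst j)" by simp
  also have "\<dots> = 2 powi (1 - fst j)" by (simp add: power_int_add power_int_diff power_int_minus field_simps)
  also have "\<dots> \<le> 2 powi (- fst i)" using assms by (intro power_int_increasing) auto
  also have "\<dots> \<le> letter_weight i"
    unfolding letter_weight_def by (simp add: mult_le_cancel_left1 not_less)
  finally show ?thesis .
qed

lemma letter_weight_inj: "letter_weight i = letter_weight j \<Longrightarrow> i = j"
proof -
  assume eq: "letter_weight i = letter_weight j"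
  then have "fst i = fst j" using letter_weight_less[of i j] letter_weight_less[of j i] by force
  then have "to_nat (snd i) = to_nat (snd j)"
    using eq by (simp add: letter_weight_def)
  then show "i = j" using \<open>fst i = fst j\<close> by (simp add: prod_eq_iff)
qed

text \<open>
  Think of \<open>A p\<close> as the set of walls around \<open>p\<close>, where the first component of a wall is its level. The
  hypotheses say that the walls around a point are nested one inside another by level, and that two
  walls with a common point are comparable. Such a family is the edge set of a tree: from a base
  point \<open>o'\<close>, the way to \<open>p\<close> first leaves the walls in \<open>A o' - A p\<close>, innermost first, and then
  enters those in \<open>A p - A o'\<close>, outermost first. The code \<open>enc\<close> turns this order into the order of
  the rationals, negative numbers for the walls around \<open>o'\<close>. Hence the way to \<open>p\<close> becomes a finite
  set of rationals, and the ways to \<open>p\<close> and \<open>q\<close> have an initial segment in common and separate for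
  good after it.
\<close>

lemma nested_levels_tree_map:
  fixes A :: "'p \<Rightarrow> (int \<times> 'b :: countable) set"
  assumes level: "\<And>p k a b. p \<in> P \<Longrightarrow> (k, a) \<in> A p \<Longrightarrow> (k, b) \<in> A p \<Longrightarrow> a = b"
    and nested: "\<And>p q j k a b. p \<in> P \<Longrightarrow> q \<in> P \<Longrightarrow> j < k \<Longrightarrow>
      (j, a) \<in> A p \<Longrightarrow> (j, a) \<in> A q \<Longrightarrow> (k, b) \<in> A p \<Longrightarrow> (k, b) \<in> A q"
    and fin: "\<And>p q. p \<in> P \<Longrightarrow> q \<in> P \<Longrightarrow> finite (sym_diff (A p) (A q))"
  shows "\<exists>\<phi>. (\<forall>p\<in>P. \<phi> p \<in> tree_points ext_verts ext_edges) \<and>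
    (\<forall>p\<in>P. \<forall>q\<in>P. tree_dist ext_verts ext_edges (\<lambda>_. 1) (\<phi> p) (\<phi> q)
      = real (card (sym_diff (A p) (A q))))"
proof (cases "P = {}")
  case False
  then obtain o' where o: "o' \<in> P" by blast
  define W where "W p = sym_diff (A p) (A o')" for p
  define enc where "enc i = (if i \<in> A o' then - letter_weight i else letter_weight i)" for i
  have inj: "inj enc"
  proof (rule injI)
    fix i j assume "enc i = enc j"
    then show "i = j"
      using letter_weight_pos[of i] letter_weight_pos[of j] letter_weight_inj[of i j]
      by (auto simp: enc_def split: if_splits)
  qed
  have order: "(j \<in> A o' \<and> (i \<in> A o' \<longrightarrow> fst j \<le> fst i)) \<or> (j \<notin> A o' \<and> i \<notin> A o' \<and> fst i \<le> fst j)"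
    if "enc j < enc i" for i j
    using that letter_weight_less[of i j] letter_weight_less[of j i]
      letter_weight_pos[of i] letter_weight_pos[of j]
    by (force simp: enc_def split: if_splits)
  have initial: "j \<in> W q"
    if pq: "p \<in> P" "q \<in> P" and i: "i \<in> W p" "i \<in> W q" and j: "j \<in> W p" and less: "enc j < enc i"
    for p q i j
  proof (rule ccontr)
    assume jq: "j \<notin> W q"
    obtain k a l b where ij: "i = (k, a)" "j = (l, b)" by fastforce
    have ne: "i \<noteq> j" using less by auto
    consider "j \<in> A o'" "i \<in> A o'" "l \<le> k" | "j \<in> A o'" "i \<notin> A o'"
      | "j \<notin> A o'" "i \<notin> A o'" "k \<le> l"
      using order[OF less] ij by auto
    then show False
    proof cases
      case 1
      \<comment> \<open>On the way out of the walls around \<open>o'\<close>: the smaller wall \<open>j\<close> lies inside \<open>i\<close>, and \<open>q\<close> is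
      outside of \<open>i\<close>.\<close>
      then have "l < k" using level[OF o, of k a b] ne ij by (cases "l = k") auto
      then show False
        using nested[OF o pq(2), of l k b a] 1 i j jq ij by (auto simp: W_def)
    next
      case 2
      \<comment> \<open>If \<open>j\<close> surrounded \<open>q\<close>, it would be comparable to \<open>i\<close>; but \<open>p\<close> is inside \<open>i\<close> only, and
      \<open>o'\<close> is inside \<open>j\<close> only.\<close>
      have m: "j \<in> A q" "j \<notin> A p" "i \<in> A p" "i \<in> A q" using 2 i j jq by (auto simp: W_def)
      consider "l < k" | "k < l" | "l = k" by linarith
      then show False
      proof cases
        case 1
        then show False using nested[OF pq(2) o, of l k b a] m 2 ij by auto
      next
        case 2
        then show False using nested[OF pq(2,1), of k l a b] m ij by auto
      next
        case 3
        then show False using level[OF pq(2), of k a b] m ne ij by auto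
      qed
    next
      case 3
      \<comment> \<open>On the way into the walls around \<open>p\<close>: the larger wall \<open>j\<close> contains \<open>i\<close>, which surrounds \<open>q\<close>.\<close>
      have m: "j \<in> A p" "j \<notin> A q" "i \<in> A p" "i \<in> A q" using 3 i j jq by (auto simp: W_def)
      have "k < l" using level[OF pq(1), of k a b] ne ij m 3 by (cases "l = k") auto
      then show False using nested[OF pq, of k l a b] m ij by auto
    qed
  qed
  have finW: "finite (enc ` W p)" if "p \<in> P" for p
    using fin[OF that o] by (simp add: W_def)
  define \<phi> where "\<phi> p = (indicator {fin_code (enc ` W p)} :: real \<Rightarrow> real)" for p
  have "tree_dist ext_verts ext_edges (\<lambda>_. 1) (\<phi> p) (\<phi> q) = real (card (sym_diff (A p) (A q)))"
    if pq: "p \<in> P" "q \<in> P" for p q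
  proof -
    have both: "enc ` W p \<inter> enc ` W q = enc ` (W p \<inter> W q)" by (simp add: image_Int inj)
    have "tree_dist ext_verts ext_edges (\<lambda>_. 1) (\<phi> p) (\<phi> q)
        = real (card (sym_diff (enc ` W p) (enc ` W q)))"
      unfolding \<phi>_def
    proof (rule tree_dist_ext[OF finW[OF pq(1)] finW[OF pq(2)]])
      fix x y assume "x \<in> enc ` W p \<inter> enc ` W q" "y \<in> enc ` W p \<union> enc ` W q" "y < x"
      then obtain i j where ij: "i \<in> W p" "i \<in> W q" "x = enc i" "j \<in> W p \<or> j \<in> W q" "y = enc j"
        unfolding both by blast
      then have "j \<in> W p \<inter> W q"
        using initial[OF pq, of i j] initial[OF pq(2,1), of i j] \<open>y < x\<close> by blast
      then show "y \<in> enc ` W p \<inter> enc ` W q" using ij by blast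
    qed
    also have "sym_diff (enc ` W p) (enc ` W q) = enc ` sym_diff (W p) (W q)"
      by (simp add: image_Un image_set_diff inj)
    also have "card \<dots> = card (sym_diff (W p) (W q))"
      using inj by (intro card_image) (auto intro: inj_on_subset)
    also have "sym_diff (W p) (W q) = sym_diff (A p) (A q)" by (auto simp: W_def)
    finally show ?thesis .
  qed
  moreover have "\<phi> p \<in> tree_points ext_verts ext_edges" if "p \<in> P" for p
  proof -
    have "{x. \<phi> p x \<noteq> 0} = {fin_code (enc ` W p)}" by (auto simp: \<phi>_def indicator_def)
    moreover have "fin_code (enc ` W p) \<in> ext_verts" using finW[OF that] by (simp add: ext_verts_def)
    ultimately show ?thesis unfolding tree_points_def by (simp add: \<phi>_def)
  qed
  ultimately show ?thesis by blast
qed simp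

section \<open>Shifted nested grids of cubes\<close>

text \<open>
  For each colour \<open>c < n\<close> and each level \<open>k\<close>, the hyperplanes with some coordinate in
  \<open>r\<^sup>k (\<int> + c/n)\<close>, where \<open>r = 2 n + 1\<close>, cut the space of dimension \<open>n - 1\<close> into cubes of side \<open>r\<^sup>k\<close>.
  Since \<open>r c/n = 2 c + c/n\<close> differs from \<open>c/n\<close> by an integer, the hyperplanes of level \<open>k\<close> are among
  those of level \<open>k - 1\<close>, so that the cubes of one colour are nested. Since \<open>2/r < 1/n\<close>, a
  coordinate cannot be close to the hyperplanes of two colours at the same level.
\<close>

definition ratio :: "nat \<Rightarrow> int" where "ratio n = 2 * int n + 1"

definition grid_pos :: "nat \<Rightarrow> nat \<Rightarrow> int \<Rightarrow> real \<Rightarrow> real" where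
  "grid_pos n c k s = s / of_int (ratio n) powi k - real c / real n"

text \<open>
  Divide a cube of level \<open>k\<close> into its subcubes of level \<open>k - 1\<close>: the coordinate \<open>s\<close> is central
  if its subcube is not in the first or in the last of the \<open>r\<close> layers. The core of a cube consists of
  the points with all coordinates central; it is a union of subcubes of level \<open>k - 1\<close> and keeps the
  distance \<open>r\<^sup>k\<^sup>-\<^sup>1\<close> from the boundary of the cube.
\<close>

definition central :: "nat \<Rightarrow> nat \<Rightarrow> int \<Rightarrow> real \<Rightarrow> bool" where
  "central n c k s \<longleftrightarrow> 1 \<le> of_int (ratio n) * frac (grid_pos n c k s)
     \<and> of_int (ratio n) * frac (grid_pos n c k s) < of_int (ratio n) - 1"

definition cube :: "nat \<Rightarrow> nat \<Rightarrow> int \<Rightarrow> (nat \<Rightarrow> real) \<Rightarrow> int list" where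
  "cube n c k y = map (\<lambda>i. \<lfloor>grid_pos n c k (y i)\<rfloor>) [1..<n]"

definition core :: "nat \<Rightarrow> nat \<Rightarrow> int \<Rightarrow> (nat \<Rightarrow> real) \<Rightarrow> bool" where
  "core n c k y \<longleftrightarrow> (\<forall>i\<in>{1..<n}. central n c k (y i))"

text \<open>
  The walls of colour \<open>c\<close> around the point \<open>(y, t)\<close> of the upper half-space. The wall with index
  \<open>(k, z)\<close> bounds the box whose base is the core of the cube \<open>z\<close> of level \<open>k\<close> and whose height is
  the side \<open>r\<^sup>k\<close> of that cube.
\<close>

definition walls :: "nat \<Rightarrow> nat \<Rightarrow> (nat \<Rightarrow> real) \<times> real \<Rightarrow> (int \<times> int list) set" where
  "walls n c p = {(k, cube n c k (fst p)) | k. snd p \<le> of_int (ratio n) powi k \<and> core n c k (fst p)}"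

lemma ratio_gt_1: "0 < n \<Longrightarrow> (1 :: real) < of_int (ratio n)"
  by (simp add: ratio_def)

lemma ratio_powi_pos: "(0 :: real) < of_int (ratio n) powi k"
  by (simp add: ratio_def)

lemma grid_pos_refine:
  assumes "0 < n"
  shows "of_int (ratio n) * grid_pos n c k s = grid_pos n c (k - 1) s - of_int (2 * int c)"
proof -
  let ?r = "of_int (ratio n) :: real"
  have "?r powi k = ?r * ?r powi (k - 1)"
    using power_int_add[of ?r 1 "k - 1"] by (simp add: ratio_def)
  then have "?r * (s / ?r powi k) = s / ?r powi (k - 1)"
    using ratio_gt_1[OF assms] by simp
  moreover have "?r * (real c / real n) = real c / real n + 2 * real c"
    using assms by (simp add: ratio_def field_simps)
  ultimately show ?thesis unfolding grid_pos_def right_diff_distrib by simp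
qed

text \<open>
  The cell at level \<open>k - 1\<close> determines the cell at level \<open>k\<close> and whether the coordinate is central
  there, because both can be read off from the integer \<open>\<lfloor>r * grid_pos n c k s\<rfloor>\<close>.
\<close>

lemma cell_refine:
  assumes n: "0 < n" and same: "\<lfloor>grid_pos n c (k - 1) s\<rfloor> = \<lfloor>grid_pos n c (k - 1) s'\<rfloor>"
  shows "\<lfloor>grid_pos n c k s\<rfloor> = \<lfloor>grid_pos n c k s'\<rfloor>" "central n c k s = central n c k s'"
proof -
  let ?r = "of_int (ratio n) :: real"
  have r: "0 < ratio n" by (simp add: ratio_def)
  have floor_eq: "\<lfloor>?r * grid_pos n c k s\<rfloor> = \<lfloor>?r * grid_pos n c k s'\<rfloor>"
    unfolding grid_pos_refine[OF n] floor_diff_of_int same ..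
  have div: "\<lfloor>grid_pos n c k x\<rfloor> = \<lfloor>?r * grid_pos n c k x\<rfloor> div ratio n" for x
    using floor_divide_real_eq_div[of "ratio n" "?r * grid_pos n c k x"] r by simp
  show cell: "\<lfloor>grid_pos n c k s\<rfloor> = \<lfloor>grid_pos n c k s'\<rfloor>"
    unfolding div[of s] div[of s'] floor_eq ..
  have central: "central n c k x \<longleftrightarrow> ratio n * \<lfloor>grid_pos n c k x\<rfloor> + 1 \<le> \<lfloor>?r * grid_pos n c k x\<rfloor>
      \<and> \<lfloor>?r * grid_pos n c k x\<rfloor> < ratio n * \<lfloor>grid_pos n c k x\<rfloor> + ratio n - 1" for x
    unfolding central_def frac_def le_floor_iff floor_less_iff by (auto simp: right_diff_distrib)
  show "central n c k s = central n c k s'"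
    unfolding central cell floor_eq ..
qed

lemma cube_eq_iff:
  "cube n c k y = cube n c k y' \<longleftrightarrow>
    (\<forall>i\<in>{1..<n}. \<lfloor>grid_pos n c k (y i)\<rfloor> = \<lfloor>grid_pos n c k (y' i)\<rfloor>)"
  by (simp add: cube_def)

lemma cube_mono:
  assumes n: "0 < n" and same: "cube n c j y = cube n c j y'" and "j \<le> k"
  shows "cube n c k y = cube n c k y'"
  using \<open>j \<le> k\<close>
proof (induction k rule: int_ge_induct)
  case base
  show ?case by (rule same)
next
  case (step i)
  have "\<lfloor>grid_pos n c (i + 1) (y m)\<rfloor> = \<lfloor>grid_pos n c (i + 1) (y' m)\<rfloor>" if "m \<in> {1..<n}" for m
    by (rule cell_refine(1)[OF n]) (use step.IH that in \<open>simp add: cube_eq_iff\<close>)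
  then show ?case unfolding cube_eq_iff by blast
qed

lemma core_mono:
  assumes n: "0 < n" and same: "cube n c j y = cube n c j y'" and "j < k"
  shows "core n c k y = core n c k y'"
proof -
  have "cube n c (k - 1) y = cube n c (k - 1) y'"
    using cube_mono[OF n same] \<open>j < k\<close> by simp
  then have "central n c k (y m) = central n c k (y' m)" if "m \<in> {1..<n}" for m
    using cell_refine(2)[OF n, of c k "y m" "y' m"] that unfolding cube_eq_iff by blast
  then show ?thesis unfolding core_def by blast
qed

lemma central_near:
  assumes n: "0 < n" and central: "central n c k s" and near: "\<bar>s - s'\<bar> < of_int (ratio n) powi (k - 1)"
  shows "\<lfloor>grid_pos n c k s\<rfloor> = \<lfloor>grid_pos n c k s'\<rfloor>"
proof -
  let ?r = "of_int (ratio n) :: real"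
  have r: "0 < ?r" by (simp add: ratio_def)
  have "?r * grid_pos n c k s - ?r * grid_pos n c k s' = (s - s') / ?r powi (k - 1)"
    unfolding grid_pos_refine[OF n] by (simp add: grid_pos_def diff_divide_distrib)
  also have "\<bar>\<dots>\<bar> < 1" using near ratio_powi_pos[of n "k - 1"] by (simp add: abs_divide)
  finally have close: "\<bar>?r * grid_pos n c k s - ?r * grid_pos n c k s'\<bar> < 1" .
  have lo: "1 \<le> ?r * grid_pos n c k s - ?r * \<lfloor>grid_pos n c k s\<rfloor>"
    and hi: "?r * grid_pos n c k s - ?r * \<lfloor>grid_pos n c k s\<rfloor> < ?r - 1"
    using central by (simp_all add: central_def frac_def right_diff_distrib)
  have "?r * of_int \<lfloor>grid_pos n c k s\<rfloor> \<le> ?r * grid_pos n c k s'"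
    "?r * grid_pos n c k s' < ?r * (of_int \<lfloor>grid_pos n c k s\<rfloor> + 1)"
    using close lo hi unfolding distrib_left by linarith+
  then have "\<lfloor>grid_pos n c k s'\<rfloor> = \<lfloor>grid_pos n c k s\<rfloor>"
    using r by (intro floor_unique) simp_all
  then show ?thesis by simp
qed

lemma cell_far:
  assumes far: "of_int (ratio n) powi k \<le> \<bar>s - s'\<bar>"
  shows "\<lfloor>grid_pos n c k s\<rfloor> \<noteq> \<lfloor>grid_pos n c k s'\<rfloor>"
proof -
  have "grid_pos n c k s - grid_pos n c k s' = (s - s') / of_int (ratio n) powi k"
    by (simp add: grid_pos_def diff_divide_distrib)
  also have "1 \<le> \<bar>\<dots>\<bar>" using far ratio_powi_pos[of n k] by (simp add: abs_divide)
  finally show ?thesis by linarith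
qed

text \<open>
  A coordinate that is not central for a colour \<open>d\<close> is within \<open>r\<^sup>k\<^sup>-\<^sup>1\<close> of \<open>r\<^sup>k (\<int> + d/n)\<close>. These sets
  are \<open>r\<^sup>k/n\<close> apart for different colours, which is more than \<open>2 r\<^sup>k\<^sup>-\<^sup>1\<close>.
\<close>

lemma not_central_unique:
  assumes "c < n" "c' < n" "\<not> central n c k s" "\<not> central n c' k s"
  shows "c = c'"
proof -
  let ?r = "of_int (ratio n) :: real" let ?x = "s / of_int (ratio n) powi k"
  have r: "0 < ?r" "2 * real n < ?r" by (simp_all add: ratio_def)
  have n: "0 < n" using assms by simp
  have near: "\<exists>m :: int. \<bar>?r * (?x - real d / real n - of_int m)\<bar> \<le> 1" if "\<not> central n d k s" for d
  proof -
    let ?u = "?x - real d / real n"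
    have f: "0 \<le> ?r * frac ?u" "?r * frac ?u < ?r"
      using r frac_lt_1[of ?u] by simp_all
    have "?r * frac ?u < 1 \<or> ?r - 1 \<le> ?r * frac ?u"
      using that by (auto simp: central_def grid_pos_def)
    then show ?thesis
    proof
      assume "?r * frac ?u < 1"
      then have "\<bar>?r * (?u - of_int \<lfloor>?u\<rfloor>)\<bar> \<le> 1" using f by (simp add: frac_def)
      then show ?thesis by blast
    next
      assume "?r - 1 \<le> ?r * frac ?u"
      then have "\<bar>?r * (?u - of_int (\<lfloor>?u\<rfloor> + 1))\<bar> \<le> 1"
        using f by (simp add: frac_def algebra_simps)
      then show ?thesis by blast
    qed
  qed
  obtain m m' where m: "\<bar>?r * (?x - real c / real n - of_int m)\<bar> \<le> 1"
    "\<bar>?r * (?x - real c' / real n - of_int m')\<bar> \<le> 1"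
    using near[OF assms(3)] near[OF assms(4)] by blast
  define D where "D = int c' - int c + int n * (m' - m)"
  have "?r * (?x - real c / real n - of_int m) - ?r * (?x - real c' / real n - of_int m')
      = ?r * (of_int D / real n)"
    using n by (simp add: D_def field_simps)
  then have "\<bar>?r * (of_int D / real n)\<bar> \<le> 2" using m by linarith
  then have "?r * \<bar>of_int D\<bar> \<le> 2 * real n"
    using r n by (simp add: abs_mult pos_divide_le_eq)
  then have "?r * \<bar>of_int D\<bar> < ?r * 1" using r by linarith
  then have "\<bar>of_int D :: real\<bar> < 1" using r by (metis mult_less_cancel_left_pos)
  then have "D = 0" by linarith
  then have "int c - int c' = int n * (m' - m)" by (simp add: D_def)
  then have "int n dvd int c - int c'" by simp
  then have "int c mod int n = int c' mod int n" by (simp add: mod_eq_dvd_iff)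
  then show "c = c'" using assms by simp
qed

text \<open>
  Each of the \<open>n - 1\<close> coordinates excludes at most one of the \<open>n\<close> colours. This is the place where
  the number of trees is determined.
\<close>

lemma ex_core:
  assumes "0 < n"
  shows "\<exists>c<n. core n c k y"
proof (rule ccontr)
  assume "\<not> ?thesis"
  then have "{..<n} \<subseteq> (\<Union>i\<in>{1..<n}. {c. c < n \<and> \<not> central n c k (y i)})"
    by (auto simp: core_def)
  then have "n \<le> card (\<Union>i\<in>{1..<n}. {c. c < n \<and> \<not> central n c k (y i)})"
    using card_mono[of "\<Union>i\<in>{1..<n}. {c. c < n \<and> \<not> central n c k (y i)}" "{..<n}"] by simp
  also have "\<dots> \<le> (\<Sum>i\<in>{1..<n}. card {c. c < n \<and> \<not> central n c k (y i)})"
    by (intro card_UN_le) simp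
  also have "\<dots> \<le> (\<Sum>i\<in>{1..<n}. 1)"
    using not_central_unique by (intro sum_mono) (auto simp: card_le_Suc0_iff_eq)
  finally show False using assms by simp
qed

lemma walls_level: "(k, a) \<in> walls n c p \<Longrightarrow> (k, b) \<in> walls n c p \<Longrightarrow> a = b"
  by (auto simp: walls_def)

text \<open>
  Cores are unions of cubes of the next lower level, and all smaller cubes of the same colour
  are contained in those. Hence two boxes of one colour with a common point are comparable.
\<close>

lemma walls_nested:
  assumes "0 < n" "j < k" "(j, a) \<in> walls n c p" "(j, a) \<in> walls n c q" "(k, b) \<in> walls n c p"
  shows "(k, b) \<in> walls n c q"
proof -
  have same: "cube n c j (fst p) = cube n c j (fst q)" using assms(3,4) by (auto simp: walls_def)
  have "of_int (ratio n) powi j \<le> (of_int (ratio n) powi k :: real)"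
    using \<open>j < k\<close> ratio_gt_1[OF \<open>0 < n\<close>] by (intro power_int_increasing) auto
  then show ?thesis
    using assms(4,5) cube_mono[OF assms(1) same, of k] core_mono[OF assms(1) same, of k] \<open>j < k\<close>
    by (auto simp: walls_def)
qed

lemma powi_log:
  assumes "0 < n" "0 < t"
  shows "t \<le> of_int (ratio n) powi k \<longleftrightarrow> log (of_int (ratio n)) t \<le> of_int k"
    "of_int (ratio n) powi k \<le> t \<longleftrightarrow> of_int k \<le> log (of_int (ratio n)) t"
  using assms ratio_gt_1[OF assms(1)]
  by (simp_all add: log_le_iff le_log_iff flip: powr_real_of_int')

text \<open>
  Let \<open>h\<close> bound the heights of two points and the differences of their coordinates. At most one wall
  around a given point belongs to each level, and the levels \<open>k\<close> with \<open>snd p \<le> r\<^sup>k \<le> r h\<close> account for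
  the logarithms. Above these levels there is at most one separating wall. Indeed, if a wall
  of level \<open>k\<close> with \<open>r\<^sup>k\<^sup>-\<^sup>1 > h\<close> surrounds one of the points, then both points are in the same cube of
  level \<open>k\<close>, since the core is far from the boundary; so no wall of a higher level separates them.
\<close>

lemma walls_sym_diff_le:
  assumes n: "0 < n" and pos: "0 < snd p" "0 < snd q"
    and h: "snd p \<le> h" "snd q \<le> h" "\<And>i. i \<in> {1..<n} \<Longrightarrow> \<bar>fst p i - fst q i\<bar> \<le> h"
  shows "finite (sym_diff (walls n c p) (walls n c q))" (is "finite ?M")
    "real (card (sym_diff (walls n c p) (walls n c q))) \<le>
      log (of_int (ratio n)) (h / snd p) + log (of_int (ratio n)) (h / snd q) + 5"
proof -
  let ?r = "of_int (ratio n) :: real"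
  let ?log = "log (of_int (ratio n))"
  have hpos: "0 < h" using pos h by linarith
  define low where "low u = {w \<in> walls n c u. ?r powi (fst w - 1) \<le> h}" for u
  define H where "H = {w \<in> ?M. h < ?r powi (fst w - 1)}"
  have low: "finite (low u) \<and> real (card (low u)) \<le> ?log (h / snd u) + 2"
    if u: "0 < snd u" "snd u \<le> h" for u
  proof -
    have inj: "inj_on fst (low u)" by (auto simp: inj_on_def low_def walls_def)
    have "fst ` low u \<subseteq> {\<lceil>?log (snd u)\<rceil>..\<lfloor>?log h\<rfloor> + 1}"
    proof clarify
      fix k z assume "(k, z) \<in> low u"
      then have "snd u \<le> ?r powi k" "?r powi (k - 1) \<le> h" by (auto simp: low_def walls_def)
      then show "fst (k, z) \<in> {\<lceil>?log (snd u)\<rceil>..\<lfloor>?log h\<rfloor> + 1}"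
        using powi_log[OF n u(1), of k] powi_log[OF n hpos, of "k - 1"]
        by (simp add: ceiling_le_iff) linarith
    qed
    then have fin: "finite (low u)" and
      card: "card (low u) \<le> card {\<lceil>?log (snd u)\<rceil>..\<lfloor>?log h\<rfloor> + 1}"
      using inj finite_subset finite_imageD card_mono card_image
      by (metis finite_atLeastAtMost_int)+
    have "?log (h / snd u) = ?log h - ?log (snd u)"
      using hpos u ratio_gt_1[OF n] by (simp add: log_divide)
    moreover have "0 \<le> ?log (h / snd u)"
      using hpos u ratio_gt_1[OF n] by simp
    ultimately have "real (card {\<lceil>?log (snd u)\<rceil>..\<lfloor>?log h\<rfloor> + 1}) \<le> ?log (h / snd u) + 2"
      by (simp; linarith)
    then show ?thesis using fin card by (meson of_nat_le_iff order_trans)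
  qed
  \<comment> \<open>A separating wall above the level of \<open>h\<close> belongs to a cube that contains both points.\<close>
  have agree: "cube n c (fst w) (fst p) = cube n c (fst w) (fst q) \<and> snd w = cube n c (fst w) (fst p)"
    if "w \<in> H" for w
  proof -
    have near: "\<bar>fst p i - fst q i\<bar> < ?r powi (fst w - 1)" if "i \<in> {1..<n}" for i
      using h(3)[OF that] \<open>w \<in> H\<close> by (auto simp: H_def)
    have "w \<in> walls n c p \<or> w \<in> walls n c q" using that by (auto simp: H_def)
    then show ?thesis
    proof
      assume "w \<in> walls n c p"
      then have "core n c (fst w) (fst p)" "snd w = cube n c (fst w) (fst p)"
        by (auto simp: walls_def)
      moreover then have "cube n c (fst w) (fst p) = cube n c (fst w) (fst q)"
        unfolding cube_eq_iff using central_near[OF n _ near] by (metis core_def)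
      ultimately show ?thesis by simp
    next
      assume "w \<in> walls n c q"
      then have "core n c (fst w) (fst q)" "snd w = cube n c (fst w) (fst q)"
        by (auto simp: walls_def)
      moreover then have "cube n c (fst w) (fst q) = cube n c (fst w) (fst p)"
        unfolding cube_eq_iff using central_near[OF n] near by (metis core_def abs_minus_commute)
      ultimately show ?thesis by simp
    qed
  qed
  have le: "fst w' \<le> fst w" if w: "w \<in> H" "w' \<in> H" for w w'
  proof (rule ccontr)
    assume "\<not> fst w' \<le> fst w"
    then have less: "fst w < fst w'" by simp
    have same: "cube n c (fst w) (fst p) = cube n c (fst w) (fst q)" using agree[OF w(1)] by blast
    have "h < ?r powi (fst w' - 1)" using w(2) by (simp add: H_def)
    also have "\<dots> \<le> ?r powi fst w'"
      using ratio_gt_1[OF n] by (intro power_int_increasing) auto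
    finally have "snd p \<le> ?r powi fst w'" "snd q \<le> ?r powi fst w'" using h by linarith+
    then have "w' \<in> walls n c p \<longleftrightarrow> w' \<in> walls n c q"
      using core_mono[OF n same less] cube_mono[OF n same, of "fst w'"] less
      by (cases w') (auto simp: walls_def)
    then show False using w(2) by (auto simp: H_def)
  qed
  have "w = w'" if "w \<in> H" "w' \<in> H" for w w'
  proof -
    have "fst w = fst w'" using le that by (meson order_antisym)
    then show ?thesis using agree that by (metis prod_eqI)
  qed
  then have single: "H \<subseteq> {w}" if "w \<in> H" for w using that by blast
  have H: "finite H" "card H \<le> 1"
  proof -
    have "H = {} \<or> (\<exists>w. H = {w})" using single by blast
    then show "finite H" "card H \<le> 1" by auto
  qed
  have sub: "?M \<subseteq> low p \<union> low q \<union> H"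
    by (auto simp: low_def H_def not_le)
  show "finite ?M" using sub low[OF pos(1) h(1)] low[OF pos(2) h(2)] H(1)
    by (meson finite_UnI finite_subset)
  have "card ?M \<le> card (low p \<union> low q \<union> H)"
    using sub low[OF pos(1) h(1)] low[OF pos(2) h(2)] H(1) by (intro card_mono) auto
  also have "\<dots> \<le> card (low p) + card (low q) + card H"
    by (meson add_le_mono card_Un_le order_refl order_trans)
  finally have "real (card ?M) \<le> real (card (low p)) + real (card (low q)) + 1" using H(2) by simp
  then show "real (card ?M) \<le> ?log (h / snd p) + ?log (h / snd q) + 5"
    using low[OF pos(1) h(1)] low[OF pos(2) h(2)] by linarith
qed

text \<open>
  At every level \<open>k\<close> with \<open>snd p \<le> r\<^sup>k < h\<close> some colour has a wall around \<open>p\<close>, and this wall does not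
  surround \<open>q\<close>: it is too low if \<open>h\<close> is the height of \<open>q\<close>, and too narrow if \<open>h\<close> is a difference of
  coordinates. If \<open>h\<close> is the height of \<open>p\<close>, there is no such level.
\<close>

lemma walls_diff_ge:
  assumes n: "0 < n" and pos: "0 < snd p" "0 < snd q" "0 < h"
    and h: "h = snd p \<or> h = snd q \<or> (\<exists>i\<in>{1..<n}. h = \<bar>fst p i - fst q i\<bar>)"
    and fin: "\<And>c. finite (walls n c p - walls n c q)"
  shows "log (of_int (ratio n)) (h / snd p) - 1 \<le> (\<Sum>c<n. real (card (walls n c p - walls n c q)))"
proof -
  let ?r = "of_int (ratio n) :: real"
  let ?log = "log (of_int (ratio n))"
  let ?K = "{\<lceil>?log (snd p)\<rceil>..<\<lceil>?log h\<rceil>}"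
  have "?K \<subseteq> (\<Union>c<n. fst ` (walls n c p - walls n c q))"
  proof
    fix k assume "k \<in> ?K"
    then have k: "snd p \<le> ?r powi k" "?r powi k < h"
      using powi_log[OF n pos(1), of k] powi_log[OF n pos(3), of k]
      by (simp_all add: ceiling_le_iff less_ceiling_iff not_le[symmetric])
    obtain c where c: "c < n" "core n c k (fst p)" using ex_core[OF n] by blast
    then have "(k, cube n c k (fst p)) \<in> walls n c p" using k by (auto simp: walls_def)
    moreover have "(k, cube n c k (fst p)) \<notin> walls n c q"
    proof
      assume "(k, cube n c k (fst p)) \<in> walls n c q"
      then have q: "snd q \<le> ?r powi k" "cube n c k (fst p) = cube n c k (fst q)"
        by (auto simp: walls_def)
      have "h \<noteq> snd p" "h \<noteq> snd q" using k q(1) by linarith+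
      then obtain i where i: "i \<in> {1..<n}" "h = \<bar>fst p i - fst q i\<bar>" using h by blast
      then have "\<lfloor>grid_pos n c k (fst p i)\<rfloor> \<noteq> \<lfloor>grid_pos n c k (fst q i)\<rfloor>"
        using k(2) by (intro cell_far) linarith
      then show False using q(2) i(1) unfolding cube_eq_iff by blast
    qed
    ultimately show "k \<in> (\<Union>c<n. fst ` (walls n c p - walls n c q))"
      using c(1) by (intro UN_I[of c] image_eqI[of k fst "(k, cube n c k (fst p))"]) simp_all
  qed
  then have "card ?K \<le> card (\<Union>c<n. fst ` (walls n c p - walls n c q))"
    using fin by (intro card_mono) auto
  also have "\<dots> \<le> (\<Sum>c<n. card (fst ` (walls n c p - walls n c q)))" by (intro card_UN_le) simp
  also have "\<dots> \<le> (\<Sum>c<n. card (walls n c p - walls n c q))"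
    using fin by (intro sum_mono card_image_le)
  finally have "real (card ?K) \<le> real (\<Sum>c<n. card (walls n c p - walls n c q))"
    by (rule of_nat_mono)
  then have "real (card ?K) \<le> (\<Sum>c<n. real (card (walls n c p - walls n c q)))"
    by (simp only: of_nat_sum)
  moreover have "?log (h / snd p) = ?log h - ?log (snd p)"
    using pos ratio_gt_1[OF n] by (simp add: log_divide)
  moreover have "?log h - ?log (snd p) - 1 \<le> real (card ?K)" by (simp; linarith)
  ultimately show ?thesis by linarith
qed

section \<open>Horospherical coordinates\<close>

text \<open>
  Coordinates of the upper half-space model, with horizontal part indexed by \<open>{1..<n}\<close>. The height
  is the reciprocal of \<open>- \<langle>x, e\<rangle>\<close> for the light-like vector \<open>e\<close> with entries \<open>1\<close> at \<open>0\<close> and \<open>n\<close>.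
\<close>

definition horo :: "nat \<Rightarrow> (nat \<Rightarrow> real) \<Rightarrow> (nat \<Rightarrow> real) \<times> real" where
  "horo n x = ((\<lambda>i. x i / (x 0 - x n)), 1 / (x 0 - x n))"

definition extent :: "nat \<Rightarrow> (nat \<Rightarrow> real) \<times> real \<Rightarrow> (nat \<Rightarrow> real) \<times> real \<Rightarrow> real" where
  "extent n p q = Max (insert (snd p) (insert (snd q) ((\<lambda>i. \<bar>fst p i - fst q i\<bar>) ` {1..<n})))"

lemma extent_ge:
  "snd p \<le> extent n p q" "snd q \<le> extent n p q"
  "i \<in> {1..<n} \<Longrightarrow> \<bar>fst p i - fst q i\<bar> \<le> extent n p q"
  unfolding extent_def by (rule Max_ge; auto)+

lemma extent_attained:
  "extent n p q = snd p \<or> extent n p q = snd q \<or> (\<exists>i\<in>{1..<n}. extent n p q = \<bar>fst p i - fst q i\<bar>)"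
proof -
  have "extent n p q \<in> insert (snd p) (insert (snd q) ((\<lambda>i. \<bar>fst p i - fst q i\<bar>) ` {1..<n}))"
    unfolding extent_def by (intro Max_in) auto
  then show ?thesis by blast
qed

lemma extent_commute: "extent n p q = extent n q p"
  unfolding extent_def by (simp add: insert_commute abs_minus_commute)

lemma hyperbolic_coords:
  assumes "1 \<le> n" "x \<in> hyperbolic_space n"
  shows "(\<Sum>i\<in>{1..<n}. (x i)\<^sup>2) = (x 0 - x n) * (x 0 + x n) - 1" "0 < x 0 - x n"
proof -
  have x: "(\<Sum>i=1..n. x i * x i) - x 0 * x 0 = -1" "0 < x 0"
    using assms(2) by (auto simp: hyperbolic_space_def minkowski_def)
  have "{1..n} = insert n {1..<n}" using assms(1) by auto
  then show sum: "(\<Sum>i\<in>{1..<n}. (x i)\<^sup>2) = (x 0 - x n) * (x 0 + x n) - 1"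
    using x(1) by (simp add: power2_eq_square algebra_simps)
  have "0 \<le> (\<Sum>i\<in>{1..<n}. (x i)\<^sup>2)" by (intro sum_nonneg) simp
  then have "(x n)\<^sup>2 < (x 0)\<^sup>2" using sum by (simp add: power2_eq_square algebra_simps)
  then have "x n < x 0" by (rule power2_less_imp_less[OF _ less_imp_le[OF x(2)]])
  then show "0 < x 0 - x n" by simp
qed

text \<open>
  This is the distance formula of the upper half-space model.
\<close>

lemma minkowski_horo:
  assumes n: "1 \<le> n" and x: "x \<in> hyperbolic_space n" and x': "x' \<in> hyperbolic_space n"
  defines "p \<equiv> horo n x" and "q \<equiv> horo n x'"
  shows "- minkowski n x x' =
    ((snd p)\<^sup>2 + (snd q)\<^sup>2 + (\<Sum>i\<in>{1..<n}. (fst p i - fst q i)\<^sup>2)) / (2 * snd p * snd q)"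
proof -
  define w w' where "w = x 0 - x n" and "w' = x' 0 - x' n"
  define v v' where "v = x 0 + x n" and "v' = x' 0 + x' n"
  define X where "X = (\<Sum>i\<in>{1..<n}. x i * x' i)"
  have pos: "0 < w" "0 < w'"
    using hyperbolic_coords(2)[OF n x] hyperbolic_coords(2)[OF n x'] by (simp_all add: w_def w'_def)
  have "(\<Sum>i\<in>{1..<n}. (fst p i - fst q i)\<^sup>2)
      = (\<Sum>i\<in>{1..<n}. (x i)\<^sup>2 / w\<^sup>2 + (x' i)\<^sup>2 / w'\<^sup>2 - 2 / (w * w') * (x i * x' i))"
    by (simp add: p_def q_def horo_def w_def w'_def power2_diff power_divide mult_ac)
  also have "\<dots> = (w * v - 1) / w\<^sup>2 + (w' * v' - 1) / w'\<^sup>2 - 2 / (w * w') * X"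
    using hyperbolic_coords(1)[OF n x] hyperbolic_coords(1)[OF n x']
    by (simp add: sum.distrib sum_subtractf X_def w_def w'_def v_def v'_def
        flip: sum_divide_distrib sum_distrib_left)
  finally have D: "(\<Sum>i\<in>{1..<n}. (fst p i - fst q i)\<^sup>2)
    = (w * v - 1) / w\<^sup>2 + (w' * v' - 1) / w'\<^sup>2 - 2 / (w * w') * X" .
  have "{1..n} = insert n {1..<n}" using n by auto
  then have "- minkowski n x x' = x 0 * x' 0 - x n * x' n - X"
    by (simp add: minkowski_def X_def)
  also have "\<dots> = (w * v' + w' * v) / 2 - X"
    by (simp add: w_def w'_def v_def v'_def algebra_simps)
  also have "\<dots> = ((1 / w)\<^sup>2 + (1 / w')\<^sup>2
      + ((w * v - 1) / w\<^sup>2 + (w' * v' - 1) / w'\<^sup>2 - 2 / (w * w') * X)) / (2 * (1 / w) * (1 / w'))"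
    using pos by (simp add: field_simps power2_eq_square)
  also have "\<dots> = ((snd p)\<^sup>2 + (snd q)\<^sup>2 + (\<Sum>i\<in>{1..<n}. (fst p i - fst q i)\<^sup>2))
      / (2 * snd p * snd q)"
    unfolding D by (simp add: p_def q_def horo_def w_def w'_def)
  finally show ?thesis .
qed

lemma arcosh_bounds:
  fixes C :: real
  assumes "1 \<le> C"
  shows "ln C \<le> arcosh C" "arcosh C \<le> ln (2 * C)" "0 \<le> arcosh C"
proof -
  define s where "s = sqrt (C\<^sup>2 - 1)"
  have "0 \<le> s" using assms by (simp add: s_def)
  have "s \<le> sqrt (C\<^sup>2)" unfolding s_def by (rule real_sqrt_le_mono) simp
  then have "s \<le> C" using assms by simp
  have arcosh: "arcosh C = ln (C + s)" using assms by (simp add: arcosh_real_def s_def)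
  show "ln C \<le> arcosh C" "arcosh C \<le> ln (2 * C)"
    unfolding arcosh using assms \<open>0 \<le> s\<close> \<open>s \<le> C\<close> by (subst ln_le_cancel_iff; linarith)+
  then show "0 \<le> arcosh C" using assms ln_ge_zero[of C] by linarith
qed

text \<open>
  Since \<open>arcosh\<close> is \<open>ln\<close> up to an additive constant, and the numerator in the formula for
  \<open>cosh d\<close> is the square of the extent up to a factor between \<open>1\<close> and \<open>n + 1\<close>, the distance is
  \<open>G\<close> up to an additive constant. These are the two logarithms that count walls.
\<close>

lemma hyperbolic_dist_horo:
  assumes n: "1 \<le> n" and x: "x \<in> hyperbolic_space n" and x': "x' \<in> hyperbolic_space n"
  defines "p \<equiv> horo n x" and "q \<equiv> horo n x'"
  defines "G \<equiv> ln (extent n p q / snd p) + ln (extent n p q / snd q)"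
  shows "0 < snd p" "0 < snd q" "0 \<le> hyperbolic_dist n x x'"
    "G - ln 2 \<le> hyperbolic_dist n x x'" "hyperbolic_dist n x x' \<le> G + ln (real n + 1)"
proof -
  let ?h = "extent n p q"
  define D where "D = (\<Sum>i\<in>{1..<n}. (fst p i - fst q i)\<^sup>2)"
  define C where "C = - minkowski n x x'"
  show pos: "0 < snd p" "0 < snd q"
    using hyperbolic_coords(2)[OF n x] hyperbolic_coords(2)[OF n x'] by (simp_all add: p_def q_def horo_def)
  have h: "0 < ?h" using pos extent_ge(1)[of p n q] by linarith
  have C: "C = ((snd p)\<^sup>2 + (snd q)\<^sup>2 + D) / (2 * snd p * snd q)"
    using minkowski_horo[OF n x x'] by (simp add: C_def D_def p_def q_def)
  have D0: "0 \<le> D" unfolding D_def by (intro sum_nonneg) simp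
  have "2 * snd p * snd q \<le> (snd p)\<^sup>2 + (snd q)\<^sup>2" by (rule sum_squares_bound)
  then have C1: "1 \<le> C" using D0 pos by (simp add: C)
  have d: "hyperbolic_dist n x x' = arcosh C" by (simp add: hyperbolic_dist_def C_def)
  show "0 \<le> hyperbolic_dist n x x'" unfolding d by (rule arcosh_bounds(3)[OF C1])
  have sq: "(snd p)\<^sup>2 \<le> ?h\<^sup>2" "(snd q)\<^sup>2 \<le> ?h\<^sup>2"
    using pos extent_ge(1,2)[where p = p and q = q and n = n] by (intro power_mono; linarith)+
  have "D \<le> (\<Sum>i\<in>{1..<n}. ?h\<^sup>2)"
    unfolding D_def
  proof (rule sum_mono)
    fix i assume "i \<in> {1..<n}"
    then have "\<bar>fst p i - fst q i\<bar> \<le> \<bar>?h\<bar>" using extent_ge(3)[of i n p q] h by linarith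
    then show "(fst p i - fst q i)\<^sup>2 \<le> ?h\<^sup>2" unfolding abs_le_square_iff .
  qed
  then have "D \<le> (real n - 1) * ?h\<^sup>2" using n by (simp add: of_nat_diff)
  then have up: "(snd p)\<^sup>2 + (snd q)\<^sup>2 + D \<le> (real n + 1) * ?h\<^sup>2"
    using sq by (simp add: algebra_simps)
  have lo: "?h\<^sup>2 \<le> (snd p)\<^sup>2 + (snd q)\<^sup>2 + D"
    using extent_attained[of n p q]
  proof (elim disjE bexE)
    fix i assume i: "i \<in> {1..<n}" "?h = \<bar>fst p i - fst q i\<bar>"
    have "?h\<^sup>2 = (fst p i - fst q i)\<^sup>2" using i(2) by simp
    also have "\<dots> \<le> D" unfolding D_def using i(1) by (intro member_le_sum) auto
    finally show ?thesis by (simp add: add_increasing)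
  qed (use D0 in simp_all)
  define z where "z = ?h\<^sup>2 / (snd p * snd q)"
  have z: "0 < z" using h pos by (simp add: z_def)
  have G: "G = ln z"
    using h pos by (simp add: G_def z_def ln_div ln_mult power2_eq_square)
  have "z / 2 \<le> C" "C \<le> (real n + 1) * z / 2"
    using divide_right_mono[OF lo, of "2 * snd p * snd q"] divide_right_mono[OF up, of "2 * snd p * snd q"] pos
    by (simp_all add: C z_def mult_ac)
  then have "ln (z / 2) \<le> ln C" "ln (2 * C) \<le> ln ((real n + 1) * z)"
    using z C1 by (auto intro!: ln_mono)
  then show "G - ln 2 \<le> hyperbolic_dist n x x'" "hyperbolic_dist n x x' \<le> G + ln (real n + 1)"
    using arcosh_bounds(1,2)[OF C1] z by (simp_all add: d G ln_div ln_mult)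
qed

section \<open>The embedding\<close>

theorem theorem1p1:
  fixes n :: nat
  assumes "n \<ge> 2"
  shows "\<exists>(V :: real set) E len f.
           simplicial_metric_tree V E len \<and> homogeneous_graph V E \<and> (\<forall>e\<in>E. len e = 1) \<and>
           quasi_isometric_embedding
             (hyperbolic_space n) (hyperbolic_dist n)
             (power_space n (tree_points V E)) (power_dist n (tree_dist V E len)) f"
proof -
  have n0: "0 < n" "1 \<le> n" using assms by simp_all
  let ?P = "{p :: (nat \<Rightarrow> real) \<times> real. 0 < snd p}"
  let ?T = "tree_dist ext_verts ext_edges (\<lambda>_. 1)"
  let ?R = "ln (of_int (ratio n)) :: real"
  have R: "0 < ?R" using ratio_gt_1[OF n0(1)] by simp
  have upper: "finite (sym_diff (walls n c p) (walls n c q)) \<and>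
      real (card (sym_diff (walls n c p) (walls n c q))) \<le>
        (ln (extent n p q / snd p) + ln (extent n p q / snd q)) / ?R + 5"
    if "p \<in> ?P" "q \<in> ?P" for c p q
    using walls_sym_diff_le[OF n0(1), of p q "extent n p q" c] that
      extent_ge[where n = n and p = p and q = q]
    by (simp add: log_def add_divide_distrib)
  have "\<exists>\<phi>. (\<forall>p\<in>?P. \<phi> p \<in> tree_points ext_verts ext_edges) \<and>
      (\<forall>p\<in>?P. \<forall>q\<in>?P. ?T (\<phi> p) (\<phi> q) = real (card (sym_diff (walls n c p) (walls n c q))))" for c
  proof (rule nested_levels_tree_map)
    show "finite (sym_diff (walls n c p) (walls n c q))" if "p \<in> ?P" "q \<in> ?P" for p q
      using upper[OF that] by blast
    show "(k, b) \<in> walls n c q"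
      if "j < k" "(j, a) \<in> walls n c p" "(j, a) \<in> walls n c q" "(k, b) \<in> walls n c p"
      for p q j k a b
      using walls_nested[OF n0(1) that] .
    show "a = b" if "(k, a) \<in> walls n c p" "(k, b) \<in> walls n c p" for p k a b
      using walls_level[OF that] .
  qed
  then have "\<forall>c. \<exists>\<phi>. (\<forall>p\<in>?P. \<phi> p \<in> tree_points ext_verts ext_edges) \<and>
      (\<forall>p\<in>?P. \<forall>q\<in>?P. ?T (\<phi> p) (\<phi> q) = real (card (sym_diff (walls n c p) (walls n c q))))"
    by (rule allI)
  from choice[OF this] obtain \<phi> where pt: "\<And>c p. p \<in> ?P \<Longrightarrow> \<phi> c p \<in> tree_points ext_verts ext_edges"
    and dist: "\<And>c p q. p \<in> ?P \<Longrightarrow> q \<in> ?P \<Longrightarrow>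
      ?T (\<phi> c p) (\<phi> c q) = real (card (sym_diff (walls n c p) (walls n c q)))"
    by blast
  define f where "f x = (\<lambda>c\<in>{..<n}. \<phi> c (horo n x))" for x
  define l where "l = 1 + real n / ?R + real n * ?R"
  \<comment> \<open>Here \<open>real n / ?R\<close> comes from bounding the \<open>\<ell>\<^sup>2\<close> norm by the sum over the colours, and
  \<open>real n * ?R\<close> from bounding the sum by \<open>n\<close> times the \<open>\<ell>\<^sup>2\<close> norm; \<open>m\<close> collects the additive errors
  of both estimates.\<close>
  define m where "m = real n * (ln 2 / ?R + 5) + (ln (real n + 1) / ?R + 2)"
  have l: "1 \<le> l" "real n / ?R \<le> l" "real n * ?R \<le> l" using R by (auto simp: l_def)
  have m: "real n * (ln 2 / ?R + 5) \<le> m" "ln (real n + 1) / ?R + 2 \<le> m" "0 \<le> m"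
    using R by (auto simp: m_def)
  have "1 / l * hyperbolic_dist n x x' - m \<le> power_dist n ?T (f x) (f x') \<and>
      power_dist n ?T (f x) (f x') \<le> l * hyperbolic_dist n x x' + m"
    if x: "x \<in> hyperbolic_space n" "x' \<in> hyperbolic_space n" for x x'
  proof -
    define p q where "p = horo n x" and "q = horo n x'"
    define G where "G = ln (extent n p q / snd p) + ln (extent n p q / snd q)"
    define N where "N c = real (card (sym_diff (walls n c p) (walls n c q)))" for c
    let ?d = "hyperbolic_dist n x x'"
    let ?L = "power_dist n ?T (f x) (f x')"
    note d = hyperbolic_dist_horo[OF n0(2) x, folded p_def q_def, folded G_def]
    have P: "p \<in> ?P" "q \<in> ?P" using d by simp_all
    have L: "?L = L2_set N {..<n}"
      unfolding power_dist_def
      by (intro L2_set_cong) (simp_all add: f_def N_def dist[OF P] flip: p_def q_def)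
    have "?L \<le> sum N {..<n}" unfolding L by (intro L2_set_le_sum) (simp add: N_def)
    also have "\<dots> \<le> (\<Sum>c<n. G / ?R + 5)"
      using upper[OF P] by (intro sum_mono) (simp add: N_def G_def)
    also have "\<dots> \<le> real n * ((?d + ln 2) / ?R + 5)"
      using d(4) R by (simp add: divide_right_mono mult_left_mono)
    also have "\<dots> = real n / ?R * ?d + real n * (ln 2 / ?R + 5)"
      by (simp add: add_divide_distrib algebra_simps)
    also have "\<dots> \<le> l * ?d + m" using l(2) m(1) d(3) by (intro add_mono mult_right_mono)
    finally have top: "?L \<le> l * ?d + m" .
    have fin: "finite (walls n c p - walls n c q)" "finite (walls n c q - walls n c p)" for c
      using upper[OF P, of c] by auto
    have h: "0 < extent n p q" using extent_ge(1)[of p n q] P by simp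
    have "G / ?R - 2 \<le> (\<Sum>c<n. real (card (walls n c p - walls n c q)))
        + (\<Sum>c<n. real (card (walls n c q - walls n c p)))"
      using walls_diff_ge[OF n0(1), of p q "extent n p q"] walls_diff_ge[OF n0(1), of q p "extent n p q"]
        P h fin extent_attained[of n p q] extent_attained[of n q p]
      by (simp add: G_def log_def add_divide_distrib extent_commute[of n q p])
    also have "\<dots> = sum N {..<n}"
      unfolding sum.distrib[symmetric] N_def using fin
      by (intro sum.cong refl) (subst card_Un_disjoint, auto)
    also have "\<dots> \<le> (\<Sum>c<n. ?L)"
      unfolding L by (intro sum_mono member_le_L2_set) auto
    finally have "G / ?R - 2 \<le> real n * ?L" by simp
    moreover have "?d / ?R \<le> (G + ln (real n + 1)) / ?R"
      using d(5) R by (intro divide_right_mono) auto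
    ultimately have "?d / ?R - m \<le> real n * ?L"
      using m(2) by (simp add: add_divide_distrib)
    then have "(?d / ?R - m) / real n \<le> ?L" using n0 by (simp add: pos_divide_le_eq mult.commute)
    moreover have "m / real n \<le> m"
      using m(3) n0 by (simp add: divide_le_eq mult_le_cancel_left1)
    moreover have "1 / l * ?d \<le> ?d / ?R / real n"
    proof -
      have "1 / l \<le> 1 / (real n * ?R)" using l n0 R by (intro divide_left_mono) auto
      then have "1 / l * ?d \<le> 1 / (real n * ?R) * ?d" using d(3) by (rule mult_right_mono)
      then show ?thesis by (simp add: mult.commute)
    qed
    ultimately have "1 / l * ?d - m \<le> ?L" by (simp add: diff_divide_distrib)
    then show ?thesis using top by blast
  qed
  moreover have "f \<in> hyperbolic_space n \<rightarrow> power_space n (tree_points ext_verts ext_edges)"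
    unfolding power_space_def f_def using pt hyperbolic_dist_horo(1)[OF n0(2)] by auto
  ultimately have "quasi_isometric_embedding (hyperbolic_space n) (hyperbolic_dist n)
      (power_space n (tree_points ext_verts ext_edges)) (power_dist n ?T) f"
    unfolding quasi_isometric_embedding_def using l(1) m(3) by blast
  then show ?thesis
    using simplicial_metric_tree_ext homogeneous_ext
    by (intro exI[of _ ext_verts] exI[of _ ext_edges] exI[of _ "\<lambda>_. 1"] exI[of _ f]) simp
qed

end
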